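(* Let $a,\alpha,\beta\in\mathbb{C}$ be such that none of $\alpha+a,\alpha-a,\beta+a,\beta-a$ belongs to $\{0,-1,-2,\ldots\}$. Then \[ \psi(\beta+a)-\psi(\alpha+a)+\psi(\alpha-a)-\psi(\beta-a)=\frac{a(\alpha-\beta)\bigl((1+\alpha)(1+\beta)+\alpha\beta-2a^2\bigr)}{(\alpha^2-a^2)(\beta^2-a^2)}\; {}_8F_7\!\left(\left.{1,\,1,\,1+\alpha-\beta,\,1+\beta-\alpha,\,1\pm2a,\,\frac75+\frac{3(\alpha+\beta)}{10}\pm\frac{\sqrt D}{10}\atop \frac32,\,1+\alpha\pm a,\,1+\beta\pm a,\,\frac25+\frac{3(\alpha+\beta)}{10}\pm\frac{\sqrt D}{10}}\right|-\frac14\right), \] where $D=40a^2+9(\alpha-\beta)^2-4(\alpha-1)(\beta-1)$.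
   Context: $\psi(z)=\frac{d}{dz}\log\Gamma(z)$ is the digamma function. ${}_pF_q\left(\left.{a_1,\ldots,a_p\atop b_1,\ldots,b_q}\right|z\right)=\sum_{n\ge0}\frac{(a_1)_n\cdots(a_p)_n}{(b_1)_n\cdots(b_q)_n}\frac{z^n}{n!}$ with $(x)_n=x(x+1)\cdots(x+n-1)$. A parameter written $u\pm v$ stands for the two parameters $u+v$ and $u-v$ (so e.g. $1\pm2a$ contributes $1+2a$ and $1-2a$). *)

theory Defs
  imports "HOL-Analysis.Analysis"
begin

definition hypergeom :: "complex list \<Rightarrow> complex list \<Rightarrow> complex \<Rightarrow> complex" where
  "hypergeom as bs z =
     (\<Sum>n. (\<Prod>a\<leftarrow>as. pochhammer a n) / (\<Prod>b\<leftarrow>bs. pochhammer b n) * z ^ n / fact n)"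

end

theory Submission
  imports Defs
begin

text \<open>
  By the series of the digamma function the left-hand side is \<open>\<Sum>k. F 0 k\<close>, where
  \<open>F 0 k = 2a/((\<beta>+k)\<^sup>2-a\<^sup>2) - 2a/((\<alpha>+k)\<^sup>2-a\<^sup>2)\<close>.  This is the bottom row of a WZ pair
  \<open>F (n+1) k - F n k = G n (k+1) - G n k\<close> with \<open>G n k \<longlonglongrightarrow> 0\<close> as \<open>k \<longlonglongrightarrow> \<infinity>\<close>, so that summing over \<open>k\<close>
  gives \<open>(\<Sum>k. F n k) - (\<Sum>k. F (n+1) k) = G n 0\<close>.  Up to a factor \<open>(1+\<epsilon>)^n\<close> the Pochhammer symbols
  in \<open>F\<close> behave like factorials and cancel, leaving the geometric factor \<open>(1/4)^n\<close>; hence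
  \<open>\<Sum>k. F n k \<longlonglongrightarrow> 0\<close> and the left-hand side equals \<open>\<Sum>n. G n 0\<close>.  The quadratic polynomial
  \<open>P n \<alpha> \<beta>\<close> in \<open>n\<close> occurring in \<open>G n 0\<close> has discriminant \<open>D\<close>; its two linear factors produce the two
  parameter pairs containing \<open>\<surd>D\<close>.
\<close>

section \<open>Growth of Pochhammer symbols compared with factorials\<close>

text \<open>Only finitely many factors can reach r, and C absorbs those. Since C does not depend on
  A, the bound is uniform over windows of consecutive indices, wherever they start.\<close>

lemma prod_le_geometric:
  fixes f :: "nat \<Rightarrow> real"
  assumes lim: "f \<longlonglongrightarrow> 1" and nonneg: "\<And>m. f m \<ge> 0" and r: "r > 1"
  obtains C where "C > 0" "\<And>A. finite A \<Longrightarrow> prod f A \<le> C * r ^ card A"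
proof -
  from order_tendstoD(2)[OF lim r] obtain M where M: "\<And>m. m \<ge> M \<Longrightarrow> f m < r"
    by (auto simp: eventually_at_top_linorder)
  \<comment> \<open>The maximum with 1 keeps every value of \<open>h\<close> at least 1, so
    \<open>prod h {..<M}\<close> dominates the product of \<open>h\<close> over any subset of
    \<open>{..<M}\<close> and can serve as the constant.\<close>
  define h where "h m = (if m < M then max 1 (f m) else 1)" for m
  have h1: "h m \<ge> 1" for m
    by (simp add: h_def)
  have fh: "f m \<le> h m * r" for m
  proof (cases "m < M")
    case True
    have "f m * 1 \<le> max 1 (f m) * r"
      using r nonneg[of m] by (intro mult_mono) auto
    with True show ?thesis by (simp add: h_def)
  next
    case False
    with M[of m] show ?thesis by (simp add: h_def)
  qed
  show ?thesis
  proof (rule that)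
    show "prod h {..<M} > 0"
      by (intro prod_pos) (use h1 less_le_trans[OF zero_less_one] in blast)
    fix A :: "nat set" assume A: "finite A"
    have "prod f A \<le> (\<Prod>m\<in>A. h m * r)"
      using nonneg fh by (intro prod_mono) auto
    also have "\<dots> = prod h A * r ^ card A"
      by (simp add: prod.distrib)
    also have "prod h A = prod h (A \<inter> {..<M})"
      using A by (intro prod.mono_neutral_right) (auto simp: h_def)
    also have "\<dots> \<le> prod h {..<M}"
      using h1 by (intro prod_mono2) (auto intro: order_trans[OF zero_le_one])
    finally show "prod f A \<le> prod h {..<M} * r ^ card A"
      using r by (simp add: mult_right_mono)
  qed
qed

lemma inverse_of_nat_Suc_tendsto_0: "(\<lambda>m. inverse (of_nat (Suc m) :: complex)) \<longlonglongrightarrow> 0"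
  by (rule LIMSEQ_inverse_real_of_nat[THEN tendsto_of_real, where 'a = complex,
        unfolded of_real_inverse of_real_of_nat_eq of_real_0])

lemma norm_add_of_nat_ratio_tendsto:
  fixes z :: complex
  shows "(\<lambda>m. norm (z + of_nat m) / (of_nat m + 1)) \<longlonglongrightarrow> 1"
proof -
  have "(\<lambda>m. norm (1 + (z - 1) * inverse (of_nat (Suc m)))) \<longlonglongrightarrow> norm (1 + (z - 1) * 0)"
    by (intro tendsto_intros inverse_of_nat_Suc_tendsto_0)
  moreover have "norm (1 + (z - 1) * inverse (of_nat (Suc m))) = norm (z + of_nat m) / (of_nat m + 1)" for m
  proof -
    have "1 + (z - 1) * inverse (of_nat (Suc m)) = (z + of_nat m) / of_nat (Suc m)"
      by (simp add: divide_eq_eq eq_divide_eq distrib_right inverse_eq_divide del: of_nat_Suc) simp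
    thus ?thesis by (simp add: norm_divide del: of_nat_Suc)
  qed
  ultimately show ?thesis by simp
qed

text \<open>Dividing the factor z + m by m + 1 turns the Pochhammer symbol over n! into a product
  whose factors have norms tending to 1.\<close>

lemma norm_pochhammer_le:
  fixes z :: complex
  assumes "r > 1"
  obtains C where "C > 0" "\<And>n. norm (pochhammer z n) \<le> C * r ^ n * fact n"
proof -
  obtain C where C: "C > 0"
    "\<And>A. finite A \<Longrightarrow> (\<Prod>m\<in>A. norm (z + of_nat m) / (of_nat m + 1)) \<le> C * r ^ card A"
    using prod_le_geometric[OF norm_add_of_nat_ratio_tendsto _ assms, of z] by auto
  show ?thesis
  proof (rule that[OF C(1)])
    fix n
    have "norm (pochhammer z n) = (\<Prod>m<n. norm (z + of_nat m) / (of_nat m + 1)) * fact n"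
      by (simp add: pochhammer_prod fact_prod_Suc prod_dividef prod_norm[symmetric]
            atLeast0LessThan add.commute)
    thus "norm (pochhammer z n) \<le> C * r ^ n * fact n"
      using C(2)[of "{..<n}"] by (simp add: mult_right_mono)
  qed
qed

lemma add_of_nat_neq_0:
  fixes z :: complex
  assumes "z \<notin> \<int>\<^sub>\<le>\<^sub>0"
  shows "z + of_nat n \<noteq> 0"
  using assms by (metis add_eq_0_iff2 minus_of_nat_in_nonpos_Ints)

lemma pochhammer_add_of_nat_neq_0:
  fixes z :: complex
  assumes "z \<notin> \<int>\<^sub>\<le>\<^sub>0"
  shows "pochhammer (z + of_nat k) n \<noteq> 0"
  using add_of_nat_neq_0[OF assms, of "k + _"] by (simp add: pochhammer_prod add_ac)

text \<open>The reciprocal ratios (m + 1) / |z + m| also tend to 1, and their product over the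
  window \<open>{k..<k + Suc n}\<close> is bounded independently of k. The factor k + 1 later
  supplies the decay in k.\<close>

lemma fact_le_norm_pochhammer:
  fixes z :: complex
  assumes z: "z \<notin> \<int>\<^sub>\<le>\<^sub>0" and r: "r > 1"
  obtains C where "C > 0"
    "\<And>n k. fact n * (real k + 1) \<le> C * r ^ Suc n * norm (pochhammer (z + of_nat k) (Suc n))"
proof -
  let ?f = "\<lambda>m. (real m + 1) / norm (z + of_nat m)"
  have "(\<lambda>m. inverse (norm (z + of_nat m) / (of_nat m + 1))) \<longlonglongrightarrow> inverse 1"
    by (intro tendsto_inverse norm_add_of_nat_ratio_tendsto) auto
  hence "?f \<longlonglongrightarrow> 1" by simp
  then obtain C where C: "C > 0" "\<And>A. finite A \<Longrightarrow> prod ?f A \<le> C * r ^ card A"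
    using prod_le_geometric[OF _ _ r, of ?f] by auto
  show ?thesis
  proof (rule that[OF C(1)])
    fix n k
    have p: "norm (pochhammer (z + of_nat k) (Suc n)) = (\<Prod>m=k..<k + Suc n. norm (z + of_nat m))"
      by (simp add: pochhammer_prod prod_norm[symmetric] prod.shift_bounds_nat_ivl[of _ 0 k, simplified]
            prod.atLeastLessThan_shift_0[of _ k] add_ac del: prod.op_ivl_Suc)
    have q: "(\<Prod>m=k..<k + Suc n. real m + 1) = pochhammer (real k + 1) (Suc n)"
      by (simp add: pochhammer_prod prod.atLeastLessThan_shift_0[of _ k] add_ac del: prod.op_ivl_Suc)
    \<comment> \<open>Because (k+1)_(n+1) = (k+1) (k+2)_n, it suffices to compare n! with (k+2)_n
      factor by factor.\<close>
    have "fact n = (\<Prod>i=0..<n. 1 + real i)"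
      by (simp add: fact_prod_Suc add_ac)
    also have "\<dots> \<le> pochhammer (real k + 1 + 1) n"
      unfolding pochhammer_prod by (intro prod_mono) auto
    finally have "fact n * (real k + 1) \<le> pochhammer (real k + 1) (Suc n)"
      unfolding pochhammer_rec by (simp add: mult.commute mult_right_mono)
    also have "\<dots> = prod ?f {k..<k + Suc n} * norm (pochhammer (z + of_nat k) (Suc n))"
      unfolding p q[symmetric] using add_of_nat_neq_0[OF z]
      by (simp add: prod.distrib[symmetric] del: prod.op_ivl_Suc)
    also have "\<dots> \<le> C * r ^ Suc n * norm (pochhammer (z + of_nat k) (Suc n))"
      using C(2)[of "{k..<k + Suc n}"] by (intro mult_right_mono) auto
    finally show "fact n * (real k + 1) \<le> C * r ^ Suc n * norm (pochhammer (z + of_nat k) (Suc n))" .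
  qed
qed

section \<open>Digamma series and the WZ pair\<close>

text \<open>The harmonic terms and Euler's constant in the two Digamma series cancel.\<close>

lemma Digamma_diff_sums:
  fixes z w :: complex
  assumes "z \<notin> \<int>\<^sub>\<le>\<^sub>0" "w \<notin> \<int>\<^sub>\<le>\<^sub>0"
  shows "(\<lambda>k. 1 / (w + of_nat k) - 1 / (z + of_nat k)) sums (Digamma z - Digamma w)"
proof -
  have *: "(\<lambda>k. inverse (of_nat (Suc k)) - inverse (u + of_nat k)) sums (Digamma u + euler_mascheroni)"
    if "u \<notin> \<int>\<^sub>\<le>\<^sub>0" for u :: complex
  proof -
    have "u \<noteq> 0" using that by auto
    thus ?thesis unfolding Digamma_def
      using summable_Digamma[of u] by (simp add: summable_sums)
  qed
  show ?thesis
    using sums_diff[OF *[OF assms(1)] *[OF assms(2)]] by (simp add: inverse_eq_divide)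
qed

text \<open>This is the WZ equation with x = \<alpha> + k, y = \<beta> + k, m = n, multiplied by the
  common denominator \<open>Q (Suc n) k\<close> and freed of the factor \<open>v n\<close>. What
  remains is a polynomial identity.\<close>

lemma WZ_certificate:
  fixes a x y m :: complex
  defines "P \<equiv> \<lambda>x y. 5 * m^2 + m * (4 + 3 * (x + y)) + 1 + (x + y) + 2 * x * y - 2 * a^2"
    and "R \<equiv> \<lambda>j. (x + a + j) * (x - a + j) * (y + a + j) * (y - a + j)"
  shows "- (m + 1) * (1 + x - y + m) * (1 + y - x + m) * (1 + 2*a + m) * (1 - 2*a + m) * (x + y + (m + 1))
           - (4 * m + 2) * (x + y + m) * R (m + 1)
         = P (x + 1) (y + 1) * R 0 - P x y * R (m + 1)"
  unfolding P_def R_def by algebra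


lemma fact_le_norm_pochhammer_three_halves: "fact n \<le> norm (pochhammer (3/2 :: complex) n)"
proof -
  have "fact n = (\<Prod>i=0..<n. 1 + real i)"
    by (simp add: fact_prod_Suc add_ac)
  also have "\<dots> \<le> pochhammer (3/2 :: real) n"
    unfolding pochhammer_prod by (intro prod_mono) auto
  also have "\<dots> = norm (of_real (pochhammer (3/2 :: real) n) :: complex)"
    by (simp add: pochhammer_nonneg)
  also have "\<dots> = norm (pochhammer (3/2 :: complex) n)"
    by (simp add: pochhammer_of_real[symmetric])
  finally show ?thesis .
qed

locale digamma_WZ =
  fixes a \<alpha> \<beta> :: complex
  assumes nonpos: "\<alpha> + a \<notin> \<int>\<^sub>\<le>\<^sub>0" "\<alpha> - a \<notin> \<int>\<^sub>\<le>\<^sub>0" "\<beta> + a \<notin> \<int>\<^sub>\<le>\<^sub>0" "\<beta> - a \<notin> \<int>\<^sub>\<le>\<^sub>0"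
begin

definition v :: "nat \<Rightarrow> complex" where
  "v n = a * (\<alpha> - \<beta>) * (fact n / pochhammer (3/2) n) * (-1/4) ^ n *
     (pochhammer (1 + \<alpha> - \<beta>) n * pochhammer (1 + \<beta> - \<alpha>) n *
      pochhammer (1 + 2*a) n * pochhammer (1 - 2*a) n)"

definition Q :: "nat \<Rightarrow> nat \<Rightarrow> complex" where
  "Q n k = pochhammer (\<alpha> + a + of_nat k) (Suc n) * pochhammer (\<alpha> - a + of_nat k) (Suc n) *
           pochhammer (\<beta> + a + of_nat k) (Suc n) * pochhammer (\<beta> - a + of_nat k) (Suc n)"

text \<open>The arguments x and y are kept free because a step from k to k + 1 raises both by
  1.\<close>

definition P :: "complex \<Rightarrow> complex \<Rightarrow> complex \<Rightarrow> complex" where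
  "P m x y = 5 * m^2 + m * (4 + 3 * (x + y)) + 1 + (x + y) + 2 * x * y - 2 * a^2"

definition F :: "nat \<Rightarrow> nat \<Rightarrow> complex" where
  "F n k = (4 * of_nat n + 2) * v n * (\<alpha> + of_nat k + (\<beta> + of_nat k) + of_nat n) / Q n k"

definition G :: "nat \<Rightarrow> nat \<Rightarrow> complex" where
  "G n k = v n * P (of_nat n) (\<alpha> + of_nat k) (\<beta> + of_nat k) / Q n k"

text \<open>The four linear factors at offset j: j = 0 gives the lowest factors of
  \<open>Q (Suc n) k\<close> and j = n + 1 the highest. Removing the former leaves
  \<open>Q n (Suc k)\<close>, removing the latter leaves \<open>Q n k\<close>.\<close>

definition R :: "nat \<Rightarrow> complex \<Rightarrow> complex" where
  "R k j = (\<alpha> + of_nat k + a + j) * (\<alpha> + of_nat k - a + j) *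
           (\<beta> + of_nat k + a + j) * (\<beta> + of_nat k - a + j)"

lemma Q_neq_0: "Q n k \<noteq> 0"
  unfolding Q_def using nonpos by (simp add: pochhammer_add_of_nat_neq_0 del: pochhammer_Suc)

lemma Q_Suc_left: "Q (Suc n) k = Q n k * R k (of_nat n + 1)"
  unfolding Q_def R_def pochhammer_Suc[of _ "Suc n"] by (simp add: algebra_simps)

lemma Q_Suc_right: "Q (Suc n) k = Q n (Suc k) * R k 0"
  unfolding Q_def R_def pochhammer_rec[of _ "Suc n"] by (simp add: algebra_simps)

lemma v_Suc:
  "(4 * of_nat (Suc n) + 2) * v (Suc n) =
     - (of_nat n + 1) * (1 + \<alpha> - \<beta> + of_nat n) * (1 + \<beta> - \<alpha> + of_nat n) *
     (1 + 2*a + of_nat n) * (1 - 2*a + of_nat n) * v n"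
proof -
  \<comment> \<open>As 4(n+1) + 2 = 4(n + 3/2), the prefactor carried by \<open>F\<close> cancels
    the new factor of (3/2)_(n+1), and the 4 cancels the new 1/4. The recurrence thus has polynomial
    coefficients.\<close>
  have c: "(4 * of_nat (Suc n) + 2) / (3 / 2 + of_nat n) * (-1/4) * of_nat (Suc n) = (- (of_nat n + 1) :: complex)"
  proof -
    have "(3 / 2 + of_nat n :: complex) \<noteq> 0"
      by (auto simp: complex_eq_iff)
    hence "(4 * of_nat (Suc n) + 2) / (3 / 2 + of_nat n) = (4 :: complex)"
      by (simp add: field_simps)
    thus ?thesis by simp
  qed
  have "(4 * of_nat (Suc n) + 2) * v (Suc n) =
     ((4 * of_nat (Suc n) + 2) / (3 / 2 + of_nat n) * (-1/4) * of_nat (Suc n)) *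
     (1 + \<alpha> - \<beta> + of_nat n) * (1 + \<beta> - \<alpha> + of_nat n) *
     (1 + 2*a + of_nat n) * (1 - 2*a + of_nat n) * v n"
    unfolding v_def pochhammer_Suc fact_Suc power_Suc
    by (simp only: divide_inverse inverse_mult_distrib mult_ac of_nat_mult of_nat_fact)
  thus ?thesis unfolding c .
qed

text \<open>All four terms are written over \<open>Q (Suc n) k\<close>; their numerators then
  satisfy \<open>WZ_certificate\<close>. The differences x - y and y - x do not involve k, which is
  why \<open>v\<close> can be independent of k.\<close>

lemma WZ: "F (Suc n) k - F n k = G n (Suc k) - G n k"
proof -
  define x y where "x = \<alpha> + of_nat k" and "y = \<beta> + of_nat k"
  define m where "m = (of_nat n :: complex)"
  have diffs: "1 + x - y = 1 + \<alpha> - \<beta>" "1 + y - x = 1 + \<beta> - \<alpha>"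
    by (simp_all add: x_def y_def)
  note Q0 = Q_neq_0[of "Suc n" k]
  have R0: "R k 0 \<noteq> 0" and R1: "R k (m + 1) \<noteq> 0"
    using Q0 Q_Suc_left[of n k] Q_Suc_right[of n k] by (auto simp: m_def)
  have G1: "G n (Suc k) = v n * P m (x + 1) (y + 1) * R k 0 / Q (Suc n) k"
    using R0 Q_neq_0[of n "Suc k"] by (simp add: G_def Q_Suc_right x_def y_def m_def add_ac)
  have G0: "G n k = v n * P m x y * R k (m + 1) / Q (Suc n) k"
    using R1 Q_neq_0[of n k] by (simp add: G_def Q_Suc_left x_def y_def m_def add_ac)
  have F0: "F n k = v n * ((4 * m + 2) * (x + y + m) * R k (m + 1)) / Q (Suc n) k"
    using R1 Q_neq_0[of n k] by (simp add: F_def Q_Suc_left x_def y_def m_def add_ac)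
  define U where "U = - (m + 1) * (1 + x - y + m) * (1 + y - x + m) * (1 + 2*a + m) * (1 - 2*a + m)"
  have vU: "(4 * of_nat (Suc n) + 2) * v (Suc n) = U * v n"
    unfolding v_Suc U_def diffs m_def by (rule refl)
  have F1: "F (Suc n) k = v n * (U * (x + y + (m + 1))) / Q (Suc n) k"
  proof -
    have "F (Suc n) k = U * v n * (x + y + (m + 1)) / Q (Suc n) k"
      unfolding F_def vU by (simp add: x_def y_def m_def add_ac)
    thus ?thesis by (simp add: mult_ac)
  qed
  have "U * (x + y + (m + 1)) - (4 * m + 2) * (x + y + m) * R k (m + 1) = P m (x + 1) (y + 1) * R k 0 - P m x y * R k (m + 1)"
    using WZ_certificate[of m x y a] unfolding P_def R_def U_def x_def y_def .
  thus ?thesis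
    unfolding F0 F1 G0 G1
    by (simp only: diff_divide_distrib[symmetric] mult.assoc right_diff_distrib[symmetric])
qed

lemma F_0_sums:
  "F 0 sums (Digamma (\<beta> + a) - Digamma (\<alpha> + a) + Digamma (\<alpha> - a) - Digamma (\<beta> - a))"
proof -
  have "(\<lambda>k. (1 / (\<alpha> + a + of_nat k) - 1 / (\<beta> + a + of_nat k)) + (1 / (\<beta> - a + of_nat k) - 1 / (\<alpha> - a + of_nat k)))
     sums ((Digamma (\<beta> + a) - Digamma (\<alpha> + a)) + (Digamma (\<alpha> - a) - Digamma (\<beta> - a)))"
    by (intro sums_add Digamma_diff_sums nonpos)
  moreover have "(1 / (\<alpha> + a + of_nat k) - 1 / (\<beta> + a + of_nat k)) + (1 / (\<beta> - a + of_nat k) - 1 / (\<alpha> - a + of_nat k)) = F 0 k" for k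
  proof -
    note nz = nonpos[THEN add_of_nat_neq_0, of k]
    show ?thesis
      unfolding F_def Q_def v_def using nz
      by (simp add: divide_simps) algebra
  qed
  ultimately show ?thesis by (simp add: algebra_simps)
qed

section \<open>Bounds for the WZ pair\<close>

lemma inverse_Q_upper_bound:
  assumes "r > 1"
  obtains C where "C > 0" "\<And>n k. 1 / norm (Q n k) \<le> C * (r ^ Suc n) ^ 4 / (fact n * (real k + 1)) ^ 4"
proof -
  obtain C1 C2 C3 C4 where C: "C1 > 0" "C2 > 0" "C3 > 0" "C4 > 0"
    "\<And>n k. fact n * (real k + 1) \<le> C1 * r ^ Suc n * norm (pochhammer (\<alpha> + a + of_nat k) (Suc n))"
    "\<And>n k. fact n * (real k + 1) \<le> C2 * r ^ Suc n * norm (pochhammer (\<alpha> - a + of_nat k) (Suc n))"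
    "\<And>n k. fact n * (real k + 1) \<le> C3 * r ^ Suc n * norm (pochhammer (\<beta> + a + of_nat k) (Suc n))"
    "\<And>n k. fact n * (real k + 1) \<le> C4 * r ^ Suc n * norm (pochhammer (\<beta> - a + of_nat k) (Suc n))"
    using nonpos[THEN fact_le_norm_pochhammer, OF assms] by metis
  show ?thesis
  proof (rule that)
    show "C1 * C2 * C3 * C4 > 0" using C by simp
    fix n k
    have "(fact n * (real k + 1)) ^ 4 = (fact n * (real k + 1)) * (fact n * (real k + 1)) * (fact n * (real k + 1)) * (fact n * (real k + 1))"
      by (simp add: power4_eq_xxxx)
    also have "\<dots> \<le> (C1 * r ^ Suc n * norm (pochhammer (\<alpha> + a + of_nat k) (Suc n))) *
        (C2 * r ^ Suc n * norm (pochhammer (\<alpha> - a + of_nat k) (Suc n))) *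
        (C3 * r ^ Suc n * norm (pochhammer (\<beta> + a + of_nat k) (Suc n))) *
        (C4 * r ^ Suc n * norm (pochhammer (\<beta> - a + of_nat k) (Suc n)))"
      using assms C(1-4) by (intro mult_mono C(5-8) mult_nonneg_nonneg) auto
    also have "\<dots> = C1 * C2 * C3 * C4 * (r ^ Suc n) ^ 4 * norm (Q n k)"
      unfolding Q_def norm_mult power4_eq_xxxx by (simp only: ac_simps)
    finally have le: "(fact n * (real k + 1)) ^ 4 \<le> C1 * C2 * C3 * C4 * (r ^ Suc n) ^ 4 * norm (Q n k)" .
    have "1 / norm (Q n k) = (fact n * (real k + 1)) ^ 4 / norm (Q n k) / (fact n * (real k + 1)) ^ 4"
      by simp
    also have "\<dots> \<le> C1 * C2 * C3 * C4 * (r ^ Suc n) ^ 4 / (fact n * (real k + 1)) ^ 4"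
      by (rule divide_right_mono) (use le Q_neq_0[of n k] in \<open>auto simp: divide_le_eq\<close>)
    finally show "1 / norm (Q n k) \<le> C1 * C2 * C3 * C4 * (r ^ Suc n) ^ 4 / (fact n * (real k + 1)) ^ 4" .
  qed
qed

lemma v_upper_bound:
  assumes "r > 1"
  obtains C where "C > 0" "\<And>n. norm (v n) \<le> C * (1/4) ^ n * (r ^ n * fact n) ^ 4"
proof -
  obtain C1 C2 C3 C4 where C: "C1 > 0" "C2 > 0" "C3 > 0" "C4 > 0"
    "\<And>n. norm (pochhammer (1 + \<alpha> - \<beta>) n) \<le> C1 * r ^ n * fact n"
    "\<And>n. norm (pochhammer (1 + \<beta> - \<alpha>) n) \<le> C2 * r ^ n * fact n"
    "\<And>n. norm (pochhammer (1 + 2*a) n) \<le> C3 * r ^ n * fact n"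
    "\<And>n. norm (pochhammer (1 - 2*a) n) \<le> C4 * r ^ n * fact n"
    using norm_pochhammer_le[OF assms] by metis
  show ?thesis
  proof (rule that)
    \<comment> \<open>Adding 1 keeps the constant positive when a(\<alpha> - \<beta>) = 0.\<close>
    show "(norm (a * (\<alpha> - \<beta>)) + 1) * (C1 * C2 * C3 * C4) > 0" using C by (simp add: add_nonneg_pos)
    fix n
    have A: "norm (pochhammer (1 + \<alpha> - \<beta>) n * pochhammer (1 + \<beta> - \<alpha>) n *
        pochhammer (1 + 2*a) n * pochhammer (1 - 2*a) n) \<le>
        (C1 * r ^ n * fact n) * (C2 * r ^ n * fact n) * (C3 * r ^ n * fact n) * (C4 * r ^ n * fact n)"
      unfolding norm_mult using assms C(1-4) by (intro mult_mono C(5-8) mult_nonneg_nonneg) auto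
    have B: "norm (fact n / pochhammer (3/2) n :: complex) \<le> 1"
      using fact_le_norm_pochhammer_three_halves[of n]
      by (auto simp: norm_divide divide_le_eq_1)
    have "norm (v n) \<le> (norm (a * (\<alpha> - \<beta>)) + 1) * 1 * (1/4) ^ n *
        ((C1 * r ^ n * fact n) * (C2 * r ^ n * fact n) * (C3 * r ^ n * fact n) * (C4 * r ^ n * fact n))"
      unfolding v_def norm_mult[of "_ * _ * (_ / _) * _"] norm_mult[of "_ * _ * (_ / _)"] norm_mult[of "_ * _" "_ / _"]
      using assms C(1-4)
      by (intro mult_mono A B) (auto simp: norm_power norm_divide intro!: mult_nonneg_nonneg)
    thus "norm (v n) \<le> (norm (a * (\<alpha> - \<beta>)) + 1) * (C1 * C2 * C3 * C4) * (1/4) ^ n * (r ^ n * fact n) ^ 4"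
      unfolding power4_eq_xxxx by (simp only: ac_simps mult_1_left)
  qed
qed


text \<open>The fourth powers of n! in the bounds for \<open>v\<close> and 1/\<open>Q\<close>
  cancel. The two linear factors of \<open>F\<close> cost (n+1)^2 (k+1), which lowers the decay
  (k+1)^(-4) to the still summable (k+1)^(-3).\<close>

lemma F_upper_bound:
  obtains C q :: real where "C > 0" "0 < q" "q < 1"
    "\<And>n k. norm (F n k) \<le> C * ((real n + 1)^2 * q ^ n) * (1 / (real k + 1)^3)"
proof -
  \<comment> \<open>The bounds for \<open>v\<close> and 1/\<open>Q\<close> each grow like r^(4n), so
    r^8 < 4 is required; 1.1^8 is about 2.14.\<close>
  define r q :: real where "r = 11/10" and "q = (r ^ 4 * r ^ 4) / 4"
  have r: "r > 1" and q: "0 < q" "q < 1"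
    by (simp_all add: q_def r_def power_divide)
  obtain C1 where C1: "C1 > 0" "\<And>n. norm (v n) \<le> C1 * (1/4) ^ n * (r ^ n * fact n) ^ 4"
    using v_upper_bound[OF r] by blast
  obtain C2 where C2: "C2 > 0"
    "\<And>n k. 1 / norm (Q n k) \<le> C2 * (r ^ Suc n) ^ 4 / (fact n * (real k + 1)) ^ 4"
    using inverse_Q_upper_bound[OF r] by blast
  \<comment> \<open>The 3 comes from 2k + n \<le> 3(n+1)(k+1).\<close>
  define S where "S = norm \<alpha> + norm \<beta> + 3"
  have S: "S > 0"
    unfolding S_def by (intro add_nonneg_pos add_nonneg_nonneg) auto
  show ?thesis
  proof (rule that[OF _ q])
    show "4 * C1 * S * C2 * r ^ 4 > 0"
      using C1 C2 S r by simp
    fix n k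
    have sb: "norm (\<alpha> + of_nat k + (\<beta> + of_nat k) + of_nat n) \<le> S * (real n + 1) * (real k + 1)"
    proof -
      have "norm (\<alpha> + of_nat k + (\<beta> + of_nat k) + of_nat n) \<le> norm \<alpha> + norm \<beta> + (2 * real k + real n)"
      proof -
        have "\<alpha> + of_nat k + (\<beta> + of_nat k) + of_nat n = (\<alpha> + \<beta>) + of_nat (2 * k + n)"
          by simp
        thus ?thesis
          using norm_triangle_ineq[of "\<alpha> + \<beta>" "of_nat (2 * k + n)"] norm_triangle_ineq[of \<alpha> \<beta>]
          unfolding norm_of_nat by (simp only: of_nat_add of_nat_mult of_nat_numeral)
      qed
      also have "\<dots> \<le> norm \<alpha> * ((real n + 1) * (real k + 1)) + norm \<beta> * ((real n + 1) * (real k + 1))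
          + 3 * ((real n + 1) * (real k + 1))"
      proof (intro add_mono)
        have "1 * 1 \<le> (real n + 1) * (real k + 1)" by (intro mult_mono) auto
        thus "norm \<alpha> \<le> norm \<alpha> * ((real n + 1) * (real k + 1))"
          "norm \<beta> \<le> norm \<beta> * ((real n + 1) * (real k + 1))"
          by (simp_all add: mult_le_cancel_left1)
      qed (simp add: algebra_simps)
      finally show ?thesis by (simp add: S_def algebra_simps)
    qed
    have nb: "norm (4 * of_nat n + 2 :: complex) \<le> 4 * (real n + 1)"
      using norm_triangle_ineq[of "4 * of_nat n :: complex" 2] by (simp add: norm_mult)
    have "norm (F n k) = norm (4 * of_nat n + 2 :: complex) * norm (v n) *
        norm (\<alpha> + of_nat k + (\<beta> + of_nat k) + of_nat n) * (1 / norm (Q n k))"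
      by (simp add: F_def norm_mult norm_divide)
    also have "\<dots> \<le> (4 * (real n + 1)) * (C1 * (1/4) ^ n * (r ^ n * fact n) ^ 4) *
        (S * (real n + 1) * (real k + 1)) * (C2 * (r ^ Suc n) ^ 4 / (fact n * (real k + 1)) ^ 4)"
      using C1(1) r S
      by (intro mult_mono nb C1(2) sb C2(2) mult_nonneg_nonneg) auto
    also have "\<dots> = (4 * C1 * S * C2 * r ^ 4) * ((real n + 1)^2 * q ^ n) * (1 / (real k + 1)^3)"
    proof -
      have "(r ^ 4) ^ n = (r ^ n) ^ 4"
        by (metis mult.commute power_mult)
      hence "q ^ n = (1/4) ^ n * (r ^ n) ^ 4 * (r ^ n) ^ 4"
        unfolding q_def power_divide power_mult_distrib by simp
      thus ?thesis
        by (simp add: power_mult_distrib divide_simps power2_eq_square power3_eq_cube power4_eq_xxxx)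
    qed
    finally show "norm (F n k) \<le> (4 * C1 * S * C2 * r ^ 4) * ((real n + 1)^2 * q ^ n) * (1 / (real k + 1)^3)" .
  qed
qed

text \<open>For fixed n the numerator is quadratic in k, while 1/\<open>Q\<close> decays like
  k^(-4). Growth in n does not matter here, so the crude choice r = 2 suffices.\<close>

lemma G_tendsto_0: "G n \<longlonglongrightarrow> 0"
proof -
  obtain C2 where C2: "C2 > 0"
    "\<And>n k. 1 / norm (Q n k) \<le> C2 * (2 ^ Suc n) ^ 4 / (fact n * (real k + 1)) ^ 4"
    using inverse_Q_upper_bound[of 2] by auto
  define D :: real where "D = C2 * (2 ^ Suc n) ^ 4 / fact n ^ 4"
  define p where "p k = P (of_nat n) (\<alpha> + of_nat k) (\<beta> + of_nat k) / (of_nat (Suc k)) ^ 4" for k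
  have "p \<longlonglongrightarrow> 0"
  proof -
    define h where "h k = inverse (of_nat (Suc k) :: complex)" for k
    have h: "h \<longlonglongrightarrow> 0"
      unfolding h_def by (rule inverse_of_nat_Suc_tendsto_0)
    \<comment> \<open>This makes \<open>p\<close> a polynomial in h = 1/(k+1) all of whose terms
      contain h^2.\<close>
    have x: "(\<alpha> + of_nat k) * h k = 1 + (\<alpha> - 1) * h k" for k and \<alpha> :: complex
      unfolding h_def by (simp add: divide_simps del: of_nat_Suc) simp
    have "p k = (5 * (of_nat n)^2 + 4 * of_nat n + 1 - 2 * a^2) * h k ^ 4
        + (3 * of_nat n + 1) * ((\<alpha> + of_nat k) * h k + (\<beta> + of_nat k) * h k) * h k ^ 3
        + 2 * ((\<alpha> + of_nat k) * h k) * ((\<beta> + of_nat k) * h k) * h k ^ 2" for k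
      unfolding p_def P_def h_def divide_inverse power_inverse[symmetric] by algebra
    hence "p = (\<lambda>k. (5 * (of_nat n)^2 + 4 * of_nat n + 1 - 2 * a^2) * h k ^ 4
        + (3 * of_nat n + 1) * ((1 + (\<alpha> - 1) * h k) + (1 + (\<beta> - 1) * h k)) * h k ^ 3
        + 2 * (1 + (\<alpha> - 1) * h k) * (1 + (\<beta> - 1) * h k) * h k ^ 2)"
      unfolding x by (intro ext)
    moreover have "\<dots> \<longlonglongrightarrow> (5 * (of_nat n)^2 + 4 * of_nat n + 1 - 2 * a^2) * 0 ^ 4
        + (3 * of_nat n + 1) * ((1 + (\<alpha> - 1) * 0) + (1 + (\<beta> - 1) * 0)) * 0 ^ 3
        + 2 * (1 + (\<alpha> - 1) * 0) * (1 + (\<beta> - 1) * 0) * 0 ^ 2"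
      by (intro tendsto_intros h)
    ultimately show ?thesis by simp
  qed
  hence "(\<lambda>k. norm (v n) * D * norm (p k)) \<longlonglongrightarrow> norm (v n) * D * norm (0 :: complex)"
    by (intro tendsto_intros)
  hence lim: "(\<lambda>k. norm (v n) * D * norm (p k)) \<longlonglongrightarrow> 0"
    by simp
  show ?thesis
  proof (rule Lim_null_comparison[OF _ lim], rule always_eventually, rule allI)
    fix k
    have "1 / norm (Q n k) \<le> D / (real k + 1) ^ 4"
      using C2(2)[of n k] by (simp add: D_def power_mult_distrib)
    hence "norm (v n) * norm (P (of_nat n) (\<alpha> + of_nat k) (\<beta> + of_nat k)) * (1 / norm (Q n k))
        \<le> norm (v n) * norm (P (of_nat n) (\<alpha> + of_nat k) (\<beta> + of_nat k)) * (D / (real k + 1) ^ 4)"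
      by (intro mult_left_mono) auto
    thus "norm (G n k) \<le> norm (v n) * D * norm (p k)"
      by (simp add: G_def p_def norm_mult norm_divide norm_power mult_ac add.commute del: of_nat_Suc)
        (simp add: add.commute)
  qed
qed

section \<open>Telescoping in k and then in n\<close>

lemma G_sums:
  "(\<lambda>n. G n 0) sums (Digamma (\<beta> + a) - Digamma (\<alpha> + a) + Digamma (\<alpha> - a) - Digamma (\<beta> - a))"
proof -
  obtain C q :: real where C: "C > 0" "0 < q" "q < 1"
    "\<And>n k. norm (F n k) \<le> C * ((real n + 1)^2 * q ^ n) * (1 / (real k + 1)^3)"
    using F_upper_bound by blast
  have cube: "summable (\<lambda>k. 1 / (real k + 1) ^ 3)"
    using summable_Suc_iff[of "\<lambda>n. inverse (real n ^ 3)"] inverse_power_summable[of 3, where 'a = real]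
    by (simp add: inverse_eq_divide add.commute)
  have F_summable: "summable (F n)" and
    F_norm: "norm (suminf (F n)) \<le> C * ((real n + 1)^2 * q ^ n) * (\<Sum>k. 1 / (real k + 1) ^ 3)" for n
  proof -
    have bound: "(\<lambda>k. C * ((real n + 1)^2 * q ^ n) * (1 / (real k + 1)^3)) sums
        (C * ((real n + 1)^2 * q ^ n) * (\<Sum>k. 1 / (real k + 1) ^ 3))"
      by (intro sums_mult summable_sums cube)
    show "summable (F n)"
      by (rule summable_comparison_test'[OF sums_summable[OF bound], of 0]) (use C(4) in auto)
    show "norm (suminf (F n)) \<le> C * ((real n + 1)^2 * q ^ n) * (\<Sum>k. 1 / (real k + 1) ^ 3)"
      unfolding sums_unique[OF bound]
      by (rule norm_suminf_le[OF C(4) sums_summable[OF bound]])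
  qed
  have "suminf (F n) - suminf (F (Suc n)) = G n 0" for n
  proof -
    \<comment> \<open>The same series is summed twice: through the WZ equation as a difference of
      row sums, and by telescoping in k.\<close>
    have "(\<lambda>k. G n (Suc k) - G n k) sums (suminf (F (Suc n)) - suminf (F n))"
      unfolding WZ[symmetric] by (intro sums_diff summable_sums F_summable)
    moreover have "(\<lambda>k. G n (Suc k) - G n k) sums (0 - G n 0)"
      by (rule telescope_sums[OF G_tendsto_0])
    ultimately show ?thesis
      using sums_unique2 by (fastforce simp: algebra_simps)
  qed
  moreover have "(\<lambda>n. suminf (F n)) \<longlonglongrightarrow> 0"
  proof (rule Lim_null_comparison[OF always_eventually[OF allI[OF F_norm]]])
    have "(\<lambda>n. (real n + 1)^2 * q ^ n) \<longlonglongrightarrow> 0"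
    proof -
      \<comment> \<open>Writing (n+1)^2 q^n as the square of (n+1) (sqrt q)^n reduces the limit to n
        x^n and x^n with |x| < 1.\<close>
      have s: "norm (sqrt q) < 1" using C(2,3) by simp
      have "(\<lambda>n. (of_nat n * sqrt q ^ n + sqrt q ^ n) ^ 2) \<longlonglongrightarrow> (0 + 0)^2"
        by (intro tendsto_intros powser_times_n_limit_0 LIMSEQ_power_zero s)
      moreover have "(of_nat n * sqrt q ^ n + sqrt q ^ n) ^ 2 = (real n + 1)^2 * q ^ n" for n
      proof -
        have "of_nat n * sqrt q ^ n + sqrt q ^ n = (real n + 1) * sqrt q ^ n"
          by (simp add: algebra_simps)
        moreover have "(sqrt q ^ n) ^ 2 = q ^ n"
          using C(2) by (simp add: real_sqrt_power[symmetric])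
        ultimately show ?thesis by (simp add: power_mult_distrib)
      qed
      ultimately show ?thesis by simp
    qed
    hence "(\<lambda>n. C * ((real n + 1)^2 * q ^ n) * (\<Sum>k. 1 / (real k + 1) ^ 3)) \<longlonglongrightarrow>
             C * 0 * (\<Sum>k. 1 / (real k + 1) ^ 3)"
      by (intro tendsto_intros)
    thus "(\<lambda>n. C * ((real n + 1)^2 * q ^ n) * (\<Sum>k. 1 / (real k + 1) ^ 3)) \<longlonglongrightarrow> 0"
      by simp
  qed
  ultimately have "(\<lambda>n. G n 0) sums (suminf (F 0) - 0)"
    using telescope_sums'[of "\<lambda>n. suminf (F n)" 0] by simp
  thus ?thesis
    using sums_unique[OF F_0_sums] by simp
qed

section \<open>Identification of the hypergeometric series\<close>

text \<open>A linear factor A + n equals A (A+1)_n / (A)_n, so the two factors of \<open>P\<close>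
  become two parameter pairs. Splitting the first factor off each Pochhammer symbol in
  \<open>Q n 0\<close> produces the denominator (\<alpha>^2 - a^2)(\<beta>^2 - a^2).\<close>

lemma G_0_eq_hypergeom_term:
  assumes AB: "A \<notin> \<int>\<^sub>\<le>\<^sub>0" "B \<notin> \<int>\<^sub>\<le>\<^sub>0"
    and P: "\<And>m. P m \<alpha> \<beta> = 5 * (A + m) * (B + m)"
  shows "G n 0 = a * (\<alpha> - \<beta>) * P 0 \<alpha> \<beta> / ((\<alpha>^2 - a^2) * (\<beta>^2 - a^2)) *
     ((\<Prod>u\<leftarrow>[1, 1, 1+\<alpha>-\<beta>, 1+\<beta>-\<alpha>, 1+2*a, 1-2*a, A+1, B+1]. pochhammer u n) /
      (\<Prod>u\<leftarrow>[3/2, 1+\<alpha>+a, 1+\<alpha>-a, 1+\<beta>+a, 1+\<beta>-a, A, B]. pochhammer u n) * (-1/4) ^ n / fact n)"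
proof -
  have shift: "(u + of_nat n) / u = pochhammer (u + 1) n / pochhammer u n" if "u \<notin> \<int>\<^sub>\<le>\<^sub>0" for u :: complex
  proof -
    have "u \<noteq> 0" "pochhammer u n \<noteq> 0"
      using pochhammer_add_of_nat_neq_0[OF that, of 0 n] that by auto
    thus ?thesis
      using pochhammer_rec[of u n] pochhammer_Suc[of u n] by (simp add: field_simps)
  qed
  have nz: "A \<noteq> 0" "B \<noteq> 0" using AB by auto
  have Pn: "P (of_nat n) \<alpha> \<beta> = P 0 \<alpha> \<beta> * (((A + of_nat n) / A) * ((B + of_nat n) / B))"
    unfolding P using nz by (simp add: field_simps)
  have Q0: "Q n 0 = ((\<alpha>^2 - a^2) * (\<beta>^2 - a^2)) * (pochhammer (1 + \<alpha> + a) n * pochhammer (1 + \<alpha> - a) n *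
              pochhammer (1 + \<beta> + a) n * pochhammer (1 + \<beta> - a) n)"
  proof -
    have "u^2 - a^2 = (u + a) * (u - a)" "u + a + 1 = 1 + u + a" "u - a + 1 = 1 + u - a" for u
      by (simp_all add: power2_eq_square square_diff_square_factored)
    thus ?thesis
      unfolding Q_def pochhammer_rec of_nat_0 add_0_right by (simp only: mult_ac)
  qed
  define w e where "w = pochhammer (1 + \<alpha> - \<beta>) n * pochhammer (1 + \<beta> - \<alpha>) n *
      pochhammer (1 + 2*a) n * pochhammer (1 - 2*a) n"
    and "e = pochhammer (1 + \<alpha> + a) n * pochhammer (1 + \<alpha> - a) n *
              pochhammer (1 + \<beta> + a) n * pochhammer (1 + \<beta> - a) n"
  \<comment> \<open>The two parameters 1 give n! twice: one cancels the n! of the series, the other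
    is the n! in \<open>v\<close>.\<close>
  have num: "(\<Prod>u\<leftarrow>[1, 1, 1+\<alpha>-\<beta>, 1+\<beta>-\<alpha>, 1+2*a, 1-2*a, A+1, B+1]. pochhammer u n) =
      fact n * (fact n * w * (pochhammer (A + 1) n * pochhammer (B + 1) n))"
    by (simp only: list.map prod_list.Cons prod_list.Nil pochhammer_fact w_def mult_ac mult_1_right mult_1_left)
  have den: "(\<Prod>u\<leftarrow>[3/2, 1+\<alpha>+a, 1+\<alpha>-a, 1+\<beta>+a, 1+\<beta>-a, A, B]. pochhammer u n) =
      pochhammer (3/2) n * e * (pochhammer A n * pochhammer B n)"
    by (simp only: list.map prod_list.Cons prod_list.Nil e_def mult_ac mult_1_right mult_1_left)
  have cancel: "fact n * x / y * z / fact n = x / y * z" for x y z :: complex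
    by simp
  show ?thesis
    unfolding num den cancel G_def of_nat_0 add_0_right Pn Q0 shift[OF AB(1)] shift[OF AB(2)] v_def
      w_def[symmetric] e_def[symmetric]
    by (simp only: divide_inverse inverse_mult_distrib mult_ac)
qed

lemma Digamma_eq_hypergeom:
  assumes "A \<notin> \<int>\<^sub>\<le>\<^sub>0" "B \<notin> \<int>\<^sub>\<le>\<^sub>0" "\<And>m. P m \<alpha> \<beta> = 5 * (A + m) * (B + m)"
  shows "Digamma (\<beta> + a) - Digamma (\<alpha> + a) + Digamma (\<alpha> - a) - Digamma (\<beta> - a) =
    a * (\<alpha> - \<beta>) * P 0 \<alpha> \<beta> / ((\<alpha>^2 - a^2) * (\<beta>^2 - a^2)) *
    hypergeom [1, 1, 1+\<alpha>-\<beta>, 1+\<beta>-\<alpha>, 1+2*a, 1-2*a, A+1, B+1]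
      [3/2, 1+\<alpha>+a, 1+\<alpha>-a, 1+\<beta>+a, 1+\<beta>-a, A, B] (-1/4)"
proof -
  let ?c = "a * (\<alpha> - \<beta>) * P 0 \<alpha> \<beta> / ((\<alpha>^2 - a^2) * (\<beta>^2 - a^2))"
  note sums = G_sums[unfolded G_0_eq_hypergeom_term[OF assms]]
  show ?thesis
  \<comment> \<open>If the prefactor vanishes, both sides are 0. Otherwise, dividing by it transfers
    summability from \<open>G_sums\<close> to the hypergeometric series, as pulling the constant out
    of \<open>suminf\<close> requires.\<close>
  proof (cases "?c = 0")
    case True
    show ?thesis
      using sums unfolding True by (simp add: sums_iff)
  next
    case False
    show ?thesis
      unfolding hypergeom_def sums_unique[OF sums]
      by (rule suminf_mult[OF summable_mult_D[OF sums_summable[OF sums] False]])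
  qed
qed

end

section \<open>Factorization of the quadratic polynomial over its discriminant\<close>

theorem theorem5:
  fixes a \<alpha> \<beta> :: complex
  assumes "\<alpha> + a \<notin> \<int>\<^sub>\<le>\<^sub>0" and "\<alpha> - a \<notin> \<int>\<^sub>\<le>\<^sub>0"
      and "\<beta> + a \<notin> \<int>\<^sub>\<le>\<^sub>0" and "\<beta> - a \<notin> \<int>\<^sub>\<le>\<^sub>0"
      and "2/5 + 3*(\<alpha>+\<beta>)/10 + csqrt (40*a^2 + 9*(\<alpha>-\<beta>)^2 - 4*(\<alpha>-1)*(\<beta>-1)) / 10 \<notin> \<int>\<^sub>\<le>\<^sub>0"
      and "2/5 + 3*(\<alpha>+\<beta>)/10 - csqrt (40*a^2 + 9*(\<alpha>-\<beta>)^2 - 4*(\<alpha>-1)*(\<beta>-1)) / 10 \<notin> \<int>\<^sub>\<le>\<^sub>0"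
  shows "Digamma (\<beta>+a) - Digamma (\<alpha>+a) + Digamma (\<alpha>-a) - Digamma (\<beta>-a) =
    a*(\<alpha>-\<beta>)*((1+\<alpha>)*(1+\<beta>) + \<alpha>*\<beta> - 2*a^2) / ((\<alpha>^2-a^2)*(\<beta>^2-a^2)) *
    (let D = 40*a^2 + 9*(\<alpha>-\<beta>)^2 - 4*(\<alpha>-1)*(\<beta>-1) in
     hypergeom
       [1, 1, 1+\<alpha>-\<beta>, 1+\<beta>-\<alpha>, 1+2*a, 1-2*a,
        7/5 + 3*(\<alpha>+\<beta>)/10 + csqrt D/10, 7/5 + 3*(\<alpha>+\<beta>)/10 - csqrt D/10]
       [3/2, 1+\<alpha>+a, 1+\<alpha>-a, 1+\<beta>+a, 1+\<beta>-a,
        2/5 + 3*(\<alpha>+\<beta>)/10 + csqrt D/10, 2/5 + 3*(\<alpha>+\<beta>)/10 - csqrt D/10]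
       (-1/4))"
proof -
  interpret digamma_WZ a \<alpha> \<beta>
    using assms(1-4) by unfold_locales
  define D where "D = 40*a^2 + 9*(\<alpha>-\<beta>)^2 - 4*(\<alpha>-1)*(\<beta>-1)"
  define A B where "A = 2/5 + 3*(\<alpha>+\<beta>)/10 + csqrt D/10" and "B = 2/5 + 3*(\<alpha>+\<beta>)/10 - csqrt D/10"
  \<comment> \<open>Completing the square: 20 P = (10m + 4 + 3(\<alpha> + \<beta>))^2 - D. Only the
    square of \<open>csqrt D\<close> enters, so the branch of the root is immaterial.\<close>
  have fac: "P m \<alpha> \<beta> = 5 * (A + m) * (B + m)" for m
  proof -
    define u where "u = 4 + 3 * (\<alpha> + \<beta>) + 10 * m"
    have "20 * (5 * (A + m) * (B + m)) = (10 * (A + m)) * (10 * (B + m))"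
      by algebra
    also have "10 * (A + m) = u + csqrt D"
      by (simp add: A_def u_def algebra_simps)
    also have "10 * (B + m) = u - csqrt D"
      by (simp add: B_def u_def algebra_simps)
    also have "(u + csqrt D) * (u - csqrt D) = u^2 - (csqrt D)^2"
      by algebra
    also have "\<dots> = 20 * P m \<alpha> \<beta>"
      unfolding power2_csqrt P_def D_def u_def by algebra
    finally show ?thesis by simp
  qed
  have P0: "(1+\<alpha>)*(1+\<beta>) + \<alpha>*\<beta> - 2*a^2 = P 0 \<alpha> \<beta>"
    by (simp add: P_def algebra_simps)
  have shift: "7/5 + 3*(\<alpha>+\<beta>)/10 + csqrt D/10 = A + 1" "7/5 + 3*(\<alpha>+\<beta>)/10 - csqrt D/10 = B + 1"
    by (simp_all add: A_def B_def)
  \<comment> \<open>\<open>A\<close> and \<open>B\<close> are lower parameters; the last two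
    hypotheses keep their Pochhammer symbols nonzero.\<close>
  have AB: "A \<notin> \<int>\<^sub>\<le>\<^sub>0" "B \<notin> \<int>\<^sub>\<le>\<^sub>0"
    unfolding A_def B_def D_def by (fact assms)+
  show ?thesis
    unfolding Let_def D_def[symmetric] A_def[symmetric] B_def[symmetric] P0 shift
    by (rule Digamma_eq_hypergeom[OF AB fac])
qed

end
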